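(* Let $q>0$. For all initial states $(\rho^l,v^l),(\rho^r,v^r)\in\mathcal D$, let $(\tilde\rho_i,\tilde v_i)=\mathcal{RS}^q_i((\rho^l,v^l),(\rho^r,v^r))$ and $\tilde w_i=\tilde v_i+p(\tilde\rho_i)$ for $i=1,2$. Then $$\mathrm{Tot.Var.}(\tilde w_1)\ \le\ \mathrm{Tot.Var.}(\tilde w_2),$$ where $\mathrm{Tot.Var.}$ is the total variation over $x\in\mathbb R$.
   Context: Pressure. $p\in C^2([0,+\infty);[0,+\infty))$ satisfies $p(0)=0$, $p'(\rho)>0$ for all $\rho>0$, and $\rho\mapsto\rho p(\rho)$ is strictly convex. System. $\mathcal D=\mathbb R^+\times\mathbb R^+$ with $\mathbb R^+=[0,+\infty)$; states are $(\rho,v)\in\mathcal D$. The Aw-Rascle system is $\partial_t\rho+\partial_x(\rho v)=0$, $\partial_t(\rho(v+p(\rho)))+\partial_x(\rho v(v+p(\rho)))=0$. Write $f_1(\rho,v)=\rho v$ and $\lambda_1(\rho,v)=v-\rho p'(\rho)$. Classical Riemann solver. For $(\rho^l,v^l),(\rho^r,v^r)\in\mathcal D$, $\mathcal{RS}((\rho^l,v^l),(\rho^r,v^r))$ is the function of $x\in\mathbb R$ (the unconstrained self-similar solution at time $t=1$ with left/right initial states separated at $x=0$) defined a.e. as follows, with $w^l=v^l+p(\rho^l)$. Let $I_2=\{\rho\ge0:\ v^l+p(\rho^l)-p(\rho)=v^r\}$; the intermediate state in cases (a) and (b) is $(\rho^m,v^m)$ with $\rho^m=\max I_2$, $v^m=v^r$.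 (a) If $v^r\le v^l$: it equals $(\rho^l,v^l)$ for $x<\sigma$, $(\rho^m,v^m)$ for $\sigma<x<v^r$, $(\rho^r,v^r)$ for $x>v^r$, where $\sigma=(\rho^mv^m-\rho^lv^l)/(\rho^m-\rho^l)$ if $\rho^m\ne\rho^l$; if $\rho^m=\rho^l$ it equals $(\rho^l,v^l)$ for $x<v^r$ and $(\rho^r,v^r)$ for $x>v^r$. (b) If $v^l<v^r\le w^l$: it equals $(\rho^l,v^l)$ for $x<\lambda_1(\rho^l,v^l)$; for $\lambda_1(\rho^l,v^l)\le x\le\lambda_1(\rho^m,v^m)$ it is the unique state $(\rho,\,w^l-p(\rho))$ with $\rho^m\le\rho\le\rho^l$ and $\lambda_1(\rho,w^l-p(\rho))=x$; $(\rho^m,v^m)$ for $\lambda_1(\rho^m,v^m)<x<v^r$; $(\rho^r,v^r)$ for $x>v^r$. (c) If $v^r>w^l$ (vacuum): it equals $(\rho^l,v^l)$ for $x<\lambda_1(\rho^l,v^l)$; for $\lambda_1(\rho^l,v^l)\le x\le w^l$ it is the state $(\rho,w^l-p(\rho))$ with $0\le\rho\le\rho^l$ and $\lambda_1=x$; $(0,x)$ for $w^l<x<v^r$; $(\rho^r,v^r)$ for $x>v^r$. $f_1(\mathcal{RS}(\cdot,\cdot)(0))$ denotes the common value of $f_1$ at the one-sided traces at $x=0$. Constrained solvers. Given $q>0$, let $I_1=\{\rho\ge0:\ \rho\,(v^l+p(\rho^l)-p(\rho))=q\}$ and, when $I_1\neq\emptyset$, $\hat\rho=\max I_1$, $\hat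 v=q/\hat\rho$, $\check\rho_1=\min I_1$, $\check v_1=q/\check\rho_1$. Let also $\check v_2=v^r$, $\check\rho_2=q/v^r$ (when $v^r>0$, which always holds when these are used below). For $i\in\{1,2\}$: if $f_1(\mathcal{RS}((\rho^l,v^l),(\rho^r,v^r))(0))\le q$, then $\mathcal{RS}^q_i((\rho^l,v^l),(\rho^r,v^r))=\mathcal{RS}((\rho^l,v^l),(\rho^r,v^r))$; otherwise $\mathcal{RS}^q_i((\rho^l,v^l),(\rho^r,v^r))(x)$ equals $\mathcal{RS}((\rho^l,v^l),(\hat\rho,\hat v))(x)$ for $x<0$ and $\mathcal{RS}((\check\rho_i,\check v_i),(\rho^r,v^r))(x)$ for $x>0$. Functions of $x$ are considered up to a.e. equality; the total variation is the essential one (that of a good representative).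
   Formalization: The formal statement also assumes that I_2 is nonempty when v^r ≤ v^l; for bounded pressures such as p(ρ)=ρ/(1+ρ) it can be empty, and then ρ^m=max I_2 and the classical solution RS are undefined. *)

theory Defs
  imports "HOL-Analysis.Analysis"
begin

section \<open>Pressure\<close>

text \<open>The pressure is only meaningful on the half-line; at the end point 0 its derivative
  is the one-sided one.\<close>

definition half_deriv :: "(real \<Rightarrow> real) \<Rightarrow> real \<Rightarrow> real" where
  "half_deriv p \<rho> = vector_derivative p (at \<rho> within {0..})"

definition C2_half_line :: "(real \<Rightarrow> real) \<Rightarrow> bool" where
  "C2_half_line p \<longleftrightarrow>
     p differentiable_on {0..} \<and>
     half_deriv p differentiable_on {0..} \<and>
     continuous_on {0..} (half_deriv (half_deriv p))"

definition strictly_convex_on :: "real set \<Rightarrow> (real \<Rightarrow> real) \<Rightarrow> bool" where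
  "strictly_convex_on S f \<longleftrightarrow>
     convex S \<and>
     (\<forall>x\<in>S. \<forall>y\<in>S. \<forall>t. x \<noteq> y \<and> 0 < t \<and> t < 1 \<longrightarrow>
        f ((1 - t) * x + t * y) < (1 - t) * f x + t * f y)"

definition pressure :: "(real \<Rightarrow> real) \<Rightarrow> bool" where
  "pressure p \<longleftrightarrow>
     C2_half_line p \<and>
     (\<forall>\<rho>\<ge>0. 0 \<le> p \<rho>) \<and>
     p 0 = 0 \<and>
     (\<forall>\<rho>>0. 0 < half_deriv p \<rho>) \<and>
     strictly_convex_on {0..} (\<lambda>\<rho>. \<rho> * p \<rho>)"


section \<open>States\<close>

type_synonym state = "real \<times> real"

definition states :: "state set" where
  "states = {0..} \<times> {0..}"

fun f1 :: "state \<Rightarrow> real" where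
  "f1 (\<rho>, v) = \<rho> * v"

fun lambda1 :: "(real \<Rightarrow> real) \<Rightarrow> state \<Rightarrow> real" where
  "lambda1 p (\<rho>, v) = v - \<rho> * half_deriv p \<rho>"

fun riemann_w :: "(real \<Rightarrow> real) \<Rightarrow> state \<Rightarrow> real" where
  "riemann_w p (\<rho>, v) = v + p \<rho>"


section \<open>Classical Riemann solver\<close>

definition I2 :: "(real \<Rightarrow> real) \<Rightarrow> state \<Rightarrow> state \<Rightarrow> real set" where
  "I2 p l r = {\<rho>. 0 \<le> \<rho> \<and> snd l + p (fst l) - p \<rho> = snd r}"

text \<open>The maxima and minima below are taken with \<open>GREATEST\<close> and \<open>LEAST\<close>, which do not require
  the set to be finite (as \<open>Max\<close> would); they are unspecified if the extremum is not attained,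
  in particular on the empty set.\<close>

definition rho_m :: "(real \<Rightarrow> real) \<Rightarrow> state \<Rightarrow> state \<Rightarrow> real" where
  "rho_m p l r = (GREATEST \<rho>. \<rho> \<in> I2 p l r)"

definition state_m :: "(real \<Rightarrow> real) \<Rightarrow> state \<Rightarrow> state \<Rightarrow> state" where
  "state_m p l r = (rho_m p l r, snd r)"

definition shock_speed :: "state \<Rightarrow> state \<Rightarrow> real" where
  "shock_speed l m = (f1 m - f1 l) / (fst m - fst l)"

text \<open>The state at abscissa \<open>x\<close> inside a 1-rarefaction fan starting at \<open>l\<close>, the density
  ranging between \<open>\<rho>0\<close> and the density of \<open>l\<close>.\<close>

definition fan_state :: "(real \<Rightarrow> real) \<Rightarrow> state \<Rightarrow> real \<Rightarrow> real \<Rightarrow> state" where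
  "fan_state p l \<rho>0 x =
     (THE u. \<exists>\<rho>. u = (\<rho>, riemann_w p l - p \<rho>) \<and> \<rho>0 \<le> \<rho> \<and> \<rho> \<le> fst l \<and> lambda1 p u = x)"

text \<open>Where the mathematical definition leaves the value at a single abscissa open, an arbitrary
  one-sided choice is made; only the a.e. class matters.\<close>

definition RS :: "(real \<Rightarrow> real) \<Rightarrow> state \<Rightarrow> state \<Rightarrow> real \<Rightarrow> state" where
  "RS p l r x =
     (let vl = snd l; vr = snd r; wl = riemann_w p l; m = state_m p l r in
      if vr \<le> vl then
        (if fst m \<noteq> fst l then
           (if x < shock_speed l m then l else if x < vr then m else r)
         else (if x < vr then l else r))
      else if vr \<le> wl then
        (if x < lambda1 p l then l
         else if x \<le> lambda1 p m then fan_state p l (fst m) x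
         else if x < vr then m
         else r)
      else
        (if x < lambda1 p l then l
         else if x \<le> wl then fan_state p l 0 x
         else if x < vr then (0, x)
         else r))"

text \<open>If \<open>p\<close> is bounded, the curve \<open>v + p \<rho> = const\<close> through the left state need not reach the
  velocity \<open>v\<^sup>r\<close> of the right state; then there is no intermediate state and the Riemann problem
  has no solution of the above form. This can only happen when the right velocity does not
  exceed the left one.\<close>

definition riemann_solvable :: "(real \<Rightarrow> real) \<Rightarrow> state \<Rightarrow> state \<Rightarrow> bool" where
  "riemann_solvable p l r \<longleftrightarrow> (snd r \<le> snd l \<longrightarrow> I2 p l r \<noteq> {})"

definition flux_at_0 :: "(real \<Rightarrow> state) \<Rightarrow> real" where
  "flux_at_0 u =
     (THE \<phi>. \<exists>ul ur. (u \<longlongrightarrow> ul) (at_left 0) \<and> (u \<longlongrightarrow> ur) (at_right 0) \<and> f1 ul = \<phi> \<and> f1 ur = \<phi>)"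


section \<open>Constrained Riemann solvers\<close>

definition I1 :: "(real \<Rightarrow> real) \<Rightarrow> real \<Rightarrow> state \<Rightarrow> real set" where
  "I1 p q l = {\<rho>. 0 \<le> \<rho> \<and> \<rho> * (snd l + p (fst l) - p \<rho>) = q}"

definition hat_state :: "(real \<Rightarrow> real) \<Rightarrow> real \<Rightarrow> state \<Rightarrow> state" where
  "hat_state p q l = (let \<rho> = (GREATEST \<rho>. \<rho> \<in> I1 p q l) in (\<rho>, q / \<rho>))"

definition check_state1 :: "(real \<Rightarrow> real) \<Rightarrow> real \<Rightarrow> state \<Rightarrow> state" where
  "check_state1 p q l = (let \<rho> = (LEAST \<rho>. \<rho> \<in> I1 p q l) in (\<rho>, q / \<rho>))"

definition check_state2 :: "real \<Rightarrow> state \<Rightarrow> state" where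
  "check_state2 q r = (q / snd r, snd r)"

definition RSq_via ::
  "(real \<Rightarrow> real) \<Rightarrow> real \<Rightarrow> state \<Rightarrow> state \<Rightarrow> state \<Rightarrow> real \<Rightarrow> state" where
  "RSq_via p q c l r =
     (if flux_at_0 (RS p l r) \<le> q then RS p l r
      else (\<lambda>x. if x < 0 then RS p l (hat_state p q l) x else RS p c r x))"

definition RSq1 :: "(real \<Rightarrow> real) \<Rightarrow> real \<Rightarrow> state \<Rightarrow> state \<Rightarrow> real \<Rightarrow> state" where
  "RSq1 p q l r = RSq_via p q (check_state1 p q l) l r"

definition RSq2 :: "(real \<Rightarrow> real) \<Rightarrow> real \<Rightarrow> state \<Rightarrow> state \<Rightarrow> real \<Rightarrow> state" where
  "RSq2 p q l r = RSq_via p q (check_state2 q r) l r"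


section \<open>Essential total variation\<close>

definition pointwise_variation :: "(real \<Rightarrow> real) \<Rightarrow> ennreal" where
  "pointwise_variation g =
     (SUP (n, t) \<in> {(n :: nat, t :: nat \<Rightarrow> real). mono_on {..n} t}.
        \<Sum>i<n. ennreal \<bar>g (t (Suc i)) - g (t i)\<bar>)"

definition tot_var :: "(real \<Rightarrow> real) \<Rightarrow> ennreal" where
  "tot_var f = (INF g \<in> {g. AE x in lborel. g x = f x}. pointwise_variation g)"

end

theory Submission
  imports Defs
begin

text \<open>Both solvers coincide with the classical one unless the flux of the classical solution
  at the origin exceeds \<open>q\<close>. In that case both total variations are compared with the
  same number \<open>\<bar>w\<^sup>r - w\<^sup>l\<bar>\<close>, where \<open>w = v + p(\<rho>)\<close>.

  The key fact is the shape of \<open>w\<close> along a classical solution (lemma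
  \<open>riemann_w_RS\<close>): it is constant across waves of the first family, it
  equals the abscissa \<open>x\<close> in a vacuum, and otherwise it changes only at the contact, so
  that it is \<open>max w\<^sup>l x\<close> for \<open>x < v\<^sup>r\<close> and \<open>w\<^sup>r\<close> for \<open>x > v\<^sup>r\<close>. As
  \<open>v\<^sup>r \<le> w\<^sup>r\<close>, this is a monotone function between \<open>w\<^sup>l\<close> and \<open>w\<^sup>r\<close>.

  The two states with the upper and lower densities of the set \<open>I1\<close> lie on the curve
  \<open>w = w\<^sup>l\<close>. The first solver therefore keeps \<open>w = w\<^sup>l\<close> across the stationary discontinuity
  at the origin, its \<open>w\<close> is again the monotone profile above, and its total variation is at
  most \<open>\<bar>w\<^sup>r - w\<^sup>l\<bar>\<close> (lemma \<open>tot_var_le_if_monotone_off_point\<close>). The second solver leaves that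
  curve at the origin, but it still has \<open>w = w\<^sup>l\<close> for \<open>x < 0\<close> and \<open>w = w\<^sup>r\<close> for
  \<open>x > v\<^sup>r\<close>, so that its total variation is at least \<open>\<bar>w\<^sup>r - w\<^sup>l\<bar>\<close> (lemma
  \<open>tot_var_ge_if_const_at_ends\<close>).

  All this presupposes that the objects in the definition of the solvers exist: the fan states
  (lemma \<open>fan_density_exists\<close>), the flux at the origin (lemma \<open>flux_at_0_on_curve\<close>),
  which also shows that a flux above \<open>q\<close> is attained on the curve \<open>w = w\<^sup>l\<close> and forces
  \<open>v\<^sup>r > 0\<close>, and the extrema of \<open>I1\<close> (lemmas \<open>I1_nonempty\<close> and \<open>finite_I1\<close>).\<close>

section \<open>Pressure laws\<close>

locale pressure_law =
  fixes p :: "real \<Rightarrow> real"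
  assumes pressure: "pressure p"
begin

lemma p_0 [simp]: "p 0 = 0"
  using pressure by (simp add: pressure_def)

lemma p_nonneg: "0 \<le> \<rho> \<Longrightarrow> 0 \<le> p \<rho>"
  using pressure by (simp add: pressure_def)

lemma p_has_derivative:
  assumes "0 \<le> \<rho>"
  shows "(p has_real_derivative half_deriv p \<rho>) (at \<rho> within {0..})"
proof -
  have "p differentiable (at \<rho> within {0..})"
    using pressure assms by (simp add: pressure_def C2_half_line_def differentiable_on_def)
  then show ?thesis
    unfolding half_deriv_def has_real_derivative_iff_has_vector_derivative
    by (simp add: vector_derivative_works)
qed

lemma continuous_on_p: "continuous_on {0..} p"
  by (rule DERIV_continuous_on) (auto intro: p_has_derivative)

lemma continuous_on_half_deriv: "continuous_on {0..} (half_deriv p)"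
  using pressure
  by (auto simp: pressure_def C2_half_line_def intro: differentiable_imp_continuous_on)

lemma p_strict_mono:
  assumes "0 \<le> a" "a < b"
  shows "p a < p b"
proof (rule DERIV_pos_imp_increasing_open [OF \<open>a < b\<close>])
  fix x assume x: "a < x" "x < b"
  with assms have "at x within {0..} = at x"
    by (intro at_within_interior) auto
  moreover have "0 < half_deriv p x"
    using pressure x assms by (simp add: pressure_def)
  ultimately show "\<exists>y. DERIV p x :> y \<and> 0 < y"
    using p_has_derivative[of x] x assms by auto
next
  show "continuous_on {a..b} p"
    using assms by (auto intro: continuous_on_subset[OF continuous_on_p])
qed

lemma p_inj: "0 \<le> a \<Longrightarrow> 0 \<le> b \<Longrightarrow> p a = p b \<Longrightarrow> a = b"
  using p_strict_mono by (metis less_irrefl linorder_neqE_linordered_idom)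

lemma p_le_iff: "0 \<le> a \<Longrightarrow> 0 \<le> b \<Longrightarrow> p a \<le> p b \<longleftrightarrow> a \<le> b"
  using p_strict_mono by (metis linorder_not_less order_le_less)

text \<open>The derivative of \<open>\<rho> p(\<rho>)\<close>. Along a curve \<open>v + p(\<rho>) = w\<close> the first
  characteristic speed is \<open>w\<close> minus this slope, so that its strict monotonicity is what makes
  rarefaction fans well defined.\<close>

definition slope :: "real \<Rightarrow> real" where
  "slope \<rho> = p \<rho> + \<rho> * half_deriv p \<rho>"

lemma slope_0 [simp]: "slope 0 = 0"
  by (simp add: slope_def)

lemma lambda1_on_curve: "lambda1 p (\<rho>, w - p \<rho>) = w - slope \<rho>"
  by (simp add: slope_def)

lemma continuous_on_slope: "continuous_on {0..} slope"
  unfolding slope_def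
  by (intro continuous_intros continuous_on_p continuous_on_half_deriv)

lemma strict_convexity:
  assumes "0 \<le> x" "0 \<le> y" "x \<noteq> y" "0 < t" "t < 1"
  shows "((1 - t) * x + t * y) * p ((1 - t) * x + t * y) < (1 - t) * (x * p x) + t * (y * p y)"
  using pressure assms by (auto simp: pressure_def strictly_convex_on_def)

text \<open>The difference quotient along the segment from \<open>a\<close> towards \<open>b\<close> is bounded by the
  full chord and tends to the slope. Staying on the segment covers the end point \<open>a = 0\<close>,
  where only a one-sided derivative is available.\<close>

lemma tangent_le:
  assumes "0 \<le> a" "0 \<le> b"
  shows "slope a * (b - a) \<le> b * p b - a * p a"
proof (cases "a = b")
  case False
  define F where "F = (\<lambda>\<rho>. \<rho> * p \<rho>)"
  define G where "G = (\<lambda>t. F (a + t * (b - a)))"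
  have F: "(F has_real_derivative slope a) (at a within {0..})"
    unfolding F_def slope_def
    by (auto intro!: derivative_eq_intros p_has_derivative assms)
  have seg: "(\<lambda>t. a + t * (b - a)) ` {0..1} \<subseteq> {0..}"
  proof clarify
    fix t :: real assume "t \<in> {0..1}"
    then have "0 \<le> (1 - t) * a + t * b" using assms by auto
    then show "0 \<le> a + t * (b - a)" by (simp add: algebra_simps)
  qed
  have "(F has_real_derivative slope a)
          (at (a + 0 * (b - a)) within (\<lambda>t. a + t * (b - a)) ` {0..1})"
    using has_field_derivative_subset[OF F seg] by simp
  moreover have "((\<lambda>t. a + t * (b - a)) has_real_derivative (b - a)) (at 0 within {0..1})"
    by (auto intro!: derivative_eq_intros)
  ultimately have "(F \<circ> (\<lambda>t. a + t * (b - a)) has_real_derivative slope a * (b - a))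
      (at 0 within {0..1})"
    by (rule DERIV_image_chain)
  then have "(G has_real_derivative slope a * (b - a)) (at 0 within {0..1})"
    by (simp add: G_def o_def)
  then have lim: "((\<lambda>t. (G t - G 0) / (t - 0)) \<longlongrightarrow> slope a * (b - a)) (at 0 within {0..1})"
    by (simp add: has_field_derivative_iff)
  have "\<forall>\<^sub>F t in at 0 within {0..1}. (G t - G 0) / (t - 0) \<le> F b - F a"
    unfolding eventually_at_topological
  proof (intro exI[of _ "{..<1}"] conjI ballI impI)
    fix t :: real assume t: "t \<in> {..<1}" "t \<noteq> 0" "t \<in> {0..1}"
    then have t': "0 < t" "t < 1" by auto
    have "G t < (1 - t) * F a + t * F b"
      using strict_convexity[OF assms False t'] by (simp add: G_def F_def algebra_simps)
    moreover have "G 0 = F a" by (simp add: G_def)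
    ultimately show "(G t - G 0) / (t - 0) \<le> F b - F a"
      using t' by (simp add: field_simps)
  qed auto
  moreover have "at 0 within {0..1::real} \<noteq> bot"
    by (simp add: at_within_Icc_at_right)
  ultimately show ?thesis
    using tendsto_upperbound[OF lim] by (simp add: F_def)
qed simp

lemma slope_strict_mono:
  assumes "0 \<le> a" "a < b"
  shows "slope a < slope b"
proof -
  have below: "slope x * (y - x) < y * p y - x * p x" if "0 \<le> x" "0 \<le> y" "x \<noteq> y" for x y
  proof -
    \<comment> \<open>Strictness comes from comparing with the tangent inequality at the midpoint.\<close>
    have "slope x * ((x + y) / 2 - x) \<le> (x + y) / 2 * p ((x + y) / 2) - x * p x"
      using that by (intro tangent_le) auto
    moreover have "(x + y) / 2 * p ((x + y) / 2) < (x * p x + y * p y) / 2"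
      using strict_convexity[OF that, of "1/2"] by (simp add: field_simps)
    moreover have "slope x * ((x + y) / 2 - x) = slope x * (y - x) / 2"
      by (simp add: field_simps)
    ultimately show ?thesis
      by (simp add: field_simps)
  qed
  have "(slope a - slope b) * (b - a) < 0"
    using below[of a b] below[of b a] assms by (simp add: algebra_simps)
  then show ?thesis
    using assms by (simp add: mult_less_0_iff)
qed

lemma slope_inj: "0 \<le> a \<Longrightarrow> 0 \<le> b \<Longrightarrow> slope a = slope b \<Longrightarrow> a = b"
  using slope_strict_mono by (metis less_irrefl linorder_neqE_linordered_idom)

lemma slope_mono: "0 \<le> a \<Longrightarrow> a \<le> b \<Longrightarrow> slope a \<le> slope b"
  using slope_strict_mono by (metis order_le_less)

lemma slope_nonneg: "0 \<le> a \<Longrightarrow> 0 \<le> slope a"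
  using slope_mono[of 0 a] by simp


section \<open>The classical Riemann solver\<close>

lemma riemann_w_eq: "riemann_w p u = snd u + p (fst u)"
  by (cases u) simp

lemma lambda1_eq: "lambda1 p u = riemann_w p u - slope (fst u)"
  by (cases u) (simp add: slope_def)

lemma I2_iff: "\<rho> \<in> I2 p l r \<longleftrightarrow> 0 \<le> \<rho> \<and> p \<rho> = riemann_w p l - snd r"
  by (auto simp: I2_def riemann_w_eq)

lemma rho_m_eq:
  assumes "\<rho> \<in> I2 p l r"
  shows "rho_m p l r = \<rho>"
  unfolding rho_m_def
  by (rule Greatest_equality) (use assms in \<open>auto simp: I2_iff intro: p_inj[THEN eq_refl]\<close>)

text \<open>For \<open>v\<^sup>r > v\<^sup>l\<close> the required pressure lies between \<open>0\<close> and \<open>p(\<rho>\<^sup>l)\<close> and is attained by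
  continuity; otherwise a bounded pressure might stay below it, and solvability is needed.\<close>

lemma curve_reaches_right_velocity:
  assumes "l \<in> states" "riemann_solvable p l r" "snd r \<le> riemann_w p l"
  shows "rho_m p l r \<in> I2 p l r"
proof -
  have "I2 p l r \<noteq> {}"
  proof (cases "snd r \<le> snd l")
    case True
    with assms show ?thesis by (simp add: riemann_solvable_def)
  next
    case False
    have "0 \<le> fst l" using assms by (auto simp: states_def)
    moreover have "continuous_on {0..fst l} p"
      by (rule continuous_on_subset[OF continuous_on_p]) auto
    ultimately obtain \<rho> where "0 \<le> \<rho>" "\<rho> \<le> fst l" "p \<rho> = riemann_w p l - snd r"
      using IVT'[of p 0 "riemann_w p l - snd r" "fst l"] False assms
      by (auto simp: riemann_w_eq)
    then show ?thesis by (auto simp: I2_iff)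
  qed
  then obtain \<rho> where "\<rho> \<in> I2 p l r" by blast
  then show ?thesis by (simp add: rho_m_eq)
qed

text \<open>Since the slope is continuous and strictly increasing, its restriction to the compact
  interval of fan densities has a continuous inverse, and the density in the fan at abscissa
  \<open>x\<close> is the value of this inverse at \<open>w - x\<close>.\<close>

lemma fan_density_exists:
  assumes "0 \<le> \<rho>\<^sub>0" "\<rho>\<^sub>0 \<le> fst l"
  obtains \<Phi> where
    "continuous_on {lambda1 p l..riemann_w p l - slope \<rho>\<^sub>0} \<Phi>"
    "\<And>x. x \<in> {lambda1 p l..riemann_w p l - slope \<rho>\<^sub>0} \<Longrightarrow>
       0 \<le> \<Phi> x \<and> slope (\<Phi> x) = riemann_w p l - x \<and>
       fan_state p l \<rho>\<^sub>0 x = (\<Phi> x, riemann_w p l - p (\<Phi> x))"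
proof -
  define w where "w = riemann_w p l"
  define S where "S = {\<rho>\<^sub>0..fst l}"
  define D where "D = the_inv_into S slope"
  have S: "S \<subseteq> {0..}" using assms by (auto simp: S_def)
  have cont: "continuous_on S slope"
    by (rule continuous_on_subset[OF continuous_on_slope S])
  have inj: "inj_on slope S"
    using S by (auto intro!: inj_onI slope_inj)
  have "continuous_on (slope ` S) D"
    unfolding D_def
    by (rule continuous_on_inv[OF cont]) (auto simp: S_def the_inv_into_f_f[OF inj, unfolded S_def])
  have surj: "y \<in> slope ` S" if "slope \<rho>\<^sub>0 \<le> y" "y \<le> slope (fst l)" for y
    using IVT'[of slope \<rho>\<^sub>0 y "fst l"] that assms cont by (auto simp: S_def)
  show thesis
  proof (rule that[of "\<lambda>x. D (w - x)"])
    show "continuous_on {lambda1 p l..riemann_w p l - slope \<rho>\<^sub>0} (\<lambda>x. D (w - x))"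
      by (rule continuous_on_compose2[OF \<open>continuous_on (slope ` S) D\<close>])
        (auto intro!: continuous_intros surj simp: lambda1_eq w_def)
  next
    fix x assume "x \<in> {lambda1 p l..riemann_w p l - slope \<rho>\<^sub>0}"
    then have mem: "w - x \<in> slope ` S"
      by (intro surj) (auto simp: lambda1_eq w_def)
    have D: "D (w - x) \<in> S" "slope (D (w - x)) = w - x"
      using the_inv_into_into[OF inj mem order_refl] f_the_inv_into_f[OF inj mem]
      by (auto simp: D_def)
    have "fan_state p l \<rho>\<^sub>0 x = (D (w - x), w - p (D (w - x)))"
      unfolding fan_state_def
    proof (rule the_equality)
      show "\<exists>\<rho>. (D (w - x), w - p (D (w - x))) = (\<rho>, riemann_w p l - p \<rho>) \<and> \<rho>\<^sub>0 \<le> \<rho> \<and>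
          \<rho> \<le> fst l \<and> lambda1 p (D (w - x), w - p (D (w - x))) = x"
        using D unfolding lambda1_on_curve by (auto simp: S_def w_def)
    next
      fix u assume "\<exists>\<rho>. u = (\<rho>, riemann_w p l - p \<rho>) \<and> \<rho>\<^sub>0 \<le> \<rho> \<and> \<rho> \<le> fst l \<and> lambda1 p u = x"
      then obtain \<rho> where \<rho>: "u = (\<rho>, w - p \<rho>)" "\<rho> \<in> S" "slope \<rho> = w - x"
        by (auto simp: S_def w_def lambda1_eq)
      then have "\<rho> = D (w - x)"
        using D inj by (metis inj_onD)
      with \<rho> show "u = (D (w - x), w - p (D (w - x)))" by simp
    qed
    then show "0 \<le> D (w - x) \<and> slope (D (w - x)) = riemann_w p l - x \<and>
        fan_state p l \<rho>\<^sub>0 x = (D (w - x), riemann_w p l - p (D (w - x)))"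
      using D S by (auto simp: w_def)
  qed
qed

text \<open>If the right state is faster than the left one, the solution is continuous up to
  the contact discontinuity. Extending the fan by its two end states amounts to clamping the
  abscissa, and writing \<open>max w x\<close> for the Riemann invariant covers the vacuum as well:
  there the density vanishes and the velocity, hence the invariant, is \<open>x\<close>.\<close>

lemma RS_rarefaction:
  assumes l: "l \<in> states" and less: "snd l < snd r"
  obtains P where "continuous_on UNIV P" "\<And>x. 0 \<le> P x"
    "\<And>x. x < snd r \<Longrightarrow> RS p l r x = (P x, max (riemann_w p l) x - p (P x))"
    "\<And>x. snd r < x \<Longrightarrow> RS p l r x = r"
proof -
  define w where "w = riemann_w p l"
  define \<rho>\<^sub>0 where "\<rho>\<^sub>0 = (if snd r \<le> w then rho_m p l r else 0)"
  define \<mu> where "\<mu> = w - slope \<rho>\<^sub>0"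
  have l0: "0 \<le> fst l" using l by (auto simp: states_def)
  have I2: "rho_m p l r \<in> I2 p l r" if "snd r \<le> w"
    using curve_reaches_right_velocity[OF l _ that[unfolded w_def]] less
    by (simp add: riemann_solvable_def)
  have \<rho>\<^sub>0: "0 \<le> \<rho>\<^sub>0" "\<rho>\<^sub>0 \<le> fst l"
  proof -
    show "0 \<le> \<rho>\<^sub>0" using I2 by (auto simp: \<rho>\<^sub>0_def I2_iff)
    have "p \<rho>\<^sub>0 \<le> p (fst l)"
      using I2 less l0 p_nonneg[of "fst l"] by (auto simp: \<rho>\<^sub>0_def I2_iff w_def riemann_w_eq)
    then show "\<rho>\<^sub>0 \<le> fst l" using \<open>0 \<le> \<rho>\<^sub>0\<close> l0 p_le_iff by blast
  qed
  obtain \<Phi> where cont: "continuous_on {lambda1 p l..\<mu>} \<Phi>"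
    and \<Phi>: "\<And>x. x \<in> {lambda1 p l..\<mu>} \<Longrightarrow> 0 \<le> \<Phi> x \<and> slope (\<Phi> x) = w - x \<and>
       fan_state p l \<rho>\<^sub>0 x = (\<Phi> x, w - p (\<Phi> x))"
    using fan_density_exists[OF \<rho>\<^sub>0] unfolding w_def \<mu>_def by metis
  have le: "lambda1 p l \<le> \<mu>"
    using slope_mono[OF \<rho>\<^sub>0] by (simp add: lambda1_eq \<mu>_def w_def)
  have \<Phi>_l: "\<Phi> (lambda1 p l) = fst l"
    using \<Phi>[of "lambda1 p l"] le l0 by (auto intro!: slope_inj simp: lambda1_eq w_def)
  have \<Phi>_\<mu>: "\<Phi> \<mu> = \<rho>\<^sub>0"
    using \<Phi>[of \<mu>] le \<rho>\<^sub>0 by (auto intro!: slope_inj simp: \<mu>_def)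
  \<comment> \<open>Up to the contact, the density is the fan density at the clamped abscissa.\<close>
  define clamp where "clamp = (\<lambda>x. max (lambda1 p l) (min \<mu> x))"
  have clamp: "clamp x \<in> {lambda1 p l..\<mu>}" for x
    using le by (auto simp: clamp_def)
  have m: "state_m p l r = (\<rho>\<^sub>0, w - p \<rho>\<^sub>0)" "lambda1 p (state_m p l r) = \<mu>" if "snd r \<le> w"
    using I2[OF that] that by (auto simp: state_m_def \<rho>\<^sub>0_def I2_iff w_def \<mu>_def slope_def)
  have \<mu>_w: "\<mu> \<le> w" using slope_nonneg[OF \<rho>\<^sub>0(1)] by (simp add: \<mu>_def)
  have \<mu>_v: "\<mu> \<le> snd r" if "snd r \<le> w"
  proof -
    have "snd r = w - p \<rho>\<^sub>0" using m(1)[OF that] by (simp add: state_m_def)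
    moreover have "0 \<le> half_deriv p \<rho>\<^sub>0 * \<rho>\<^sub>0"
      using pressure \<rho>\<^sub>0(1) by (cases "\<rho>\<^sub>0 = 0") (auto simp: pressure_def less_imp_le)
    ultimately show ?thesis by (simp add: \<mu>_def slope_def mult.commute)
  qed
  have vac: "\<mu> = w" "\<rho>\<^sub>0 = 0" if "\<not> snd r \<le> w" using that by (auto simp: \<mu>_def \<rho>\<^sub>0_def)
  have l_eq: "l = (fst l, w - p (fst l))"
    by (simp add: w_def riemann_w_eq)
  show thesis
  proof (rule that[of "\<lambda>x. \<Phi> (clamp x)"])
    show "continuous_on UNIV (\<lambda>x. \<Phi> (clamp x))"
      by (rule continuous_on_compose2[OF cont])
        (use clamp in \<open>auto simp: clamp_def intro!: continuous_intros\<close>)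
    show "0 \<le> \<Phi> (clamp x)" for x using \<Phi>[OF clamp] by simp
  next
    fix x assume x: "x < snd r"
    consider "x < lambda1 p l" | "lambda1 p l \<le> x" "x \<le> \<mu>" | "\<mu> < x" by linarith
    then show "RS p l r x = (\<Phi> (clamp x), max (riemann_w p l) x - p (\<Phi> (clamp x)))"
    proof cases
      case 1
      then have "clamp x = lambda1 p l" "max w x = w" using le \<mu>_w by (auto simp: clamp_def)
      moreover have "RS p l r x = l" using 1 less by (auto simp: RS_def Let_def)
      ultimately show ?thesis using \<Phi>_l l_eq by (simp add: w_def)
    next
      case 2
      then have "clamp x = x" "max w x = w" using \<mu>_w by (auto simp: clamp_def)
      moreover have "RS p l r x = fan_state p l \<rho>\<^sub>0 x"
        using 2 less m vac by (auto simp: RS_def Let_def w_def \<rho>\<^sub>0_def state_m_def)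
      ultimately show ?thesis using \<Phi>[of x] 2 by (simp add: w_def)
    next
      case 3
      then have "clamp x = \<mu>" using le by (auto simp: clamp_def)
      moreover have "RS p l r x = (\<rho>\<^sub>0, max w x - p \<rho>\<^sub>0)"
      proof (cases "snd r \<le> w")
        case True
        then have "max w x = w" using x by simp
        then show ?thesis using 3 less x m[OF True] True le by (auto simp: RS_def Let_def w_def)
      next
        case False
        then show ?thesis using 3 less x vac le by (auto simp: RS_def Let_def w_def)
      qed
      ultimately show ?thesis using \<Phi>_\<mu> by (simp add: w_def)
    qed
  next
    fix x assume x: "snd r < x"
    show "RS p l r x = r"
    proof (cases "snd r \<le> w")
      case True
      then show ?thesis using x less m[OF True] \<mu>_v[OF True] le
        by (auto simp: RS_def Let_def w_def)
    next
      case False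
      then show ?thesis using x less vac le by (auto simp: RS_def Let_def w_def)
    qed
  qed
qed

text \<open>If the right state is not faster than the left one, the solution is a 1-shock
  followed by a contact; the shock never overtakes the contact. The last conclusion is the
  Rankine-Hugoniot relation for a stationary shock, which makes the flux at the origin well
  defined in that case.\<close>

lemma RS_compression:
  assumes l: "l \<in> states" and le: "snd r \<le> snd l" and solvable: "riemann_solvable p l r"
  obtains \<rho> \<sigma> where "0 \<le> \<rho>" "p \<rho> = riemann_w p l - snd r" "\<sigma> \<le> snd r"
    "\<And>x. RS p l r x = (if x < \<sigma> then l else if x < snd r then (\<rho>, snd r) else r)"
    "\<sigma> = 0 \<Longrightarrow> f1 l = f1 (\<rho>, snd r)"
proof -
  have nn: "0 \<le> fst l" using l by (auto simp: states_def)
  have I2: "rho_m p l r \<in> I2 p l r"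
    using curve_reaches_right_velocity[OF l solvable] le p_nonneg[OF nn]
    by (simp add: riemann_w_eq)
  define \<rho> where "\<rho> = rho_m p l r"
  have \<rho>: "0 \<le> \<rho>" "p \<rho> = riemann_w p l - snd r"
    using I2 by (auto simp: \<rho>_def I2_iff)
  have "p (fst l) \<le> p \<rho>" using \<rho> le by (simp add: riemann_w_eq)
  then have ge: "fst l \<le> \<rho>" using p_le_iff nn \<rho> by blast
  show thesis
  proof (cases "\<rho> = fst l")
    case True
    \<comment> \<open>There is no shock; putting it at the contact removes the intermediate state.\<close>
    then have v: "snd l = snd r" using \<rho> by (simp add: riemann_w_eq)
    have "f1 l = f1 (\<rho>, snd r)" using True v by (cases l) simp
    have RS: "RS p l r x = (if x < snd r then l else r)" for x
      using True v by (simp add: RS_def Let_def state_m_def \<rho>_def[symmetric])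
    show thesis
      by (rule that[OF \<rho>, of "snd r"]) (use \<open>f1 l = f1 (\<rho>, snd r)\<close> in \<open>simp_all add: RS\<close>)
  next
    case False
    define \<sigma> where "\<sigma> = shock_speed l (\<rho>, snd r)"
    have f1_l: "f1 l = fst l * snd l" by (cases l) simp
    have pos: "0 < \<rho> - fst l" using False ge by simp
    have \<sigma>: "\<sigma> = (\<rho> * snd r - fst l * snd l) / (\<rho> - fst l)"
      by (simp add: \<sigma>_def shock_speed_def f1_l)
    have "fst l * snd r \<le> fst l * snd l" by (rule mult_left_mono[OF le nn])
    then have "\<sigma> \<le> snd r"
      using pos by (simp add: \<sigma> divide_le_eq algebra_simps)
    then show thesis
    proof (rule that[OF \<rho>])
      show "RS p l r x = (if x < \<sigma> then l else if x < snd r then (\<rho>, snd r) else r)" for x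
        using False le by (simp add: RS_def Let_def state_m_def \<rho>_def[symmetric] \<sigma>_def)
      show "f1 l = f1 (\<rho>, snd r)" if "\<sigma> = 0"
        using that pos by (simp add: \<sigma> f1_l)
    qed
  qed
qed

text \<open>The invariant \<open>w\<close> does not change across 1-waves, equals \<open>x\<close> in a
  vacuum, and jumps to its right value at the contact, which moves with velocity \<open>v\<^sup>r\<close>.\<close>

lemma riemann_w_RS:
  assumes "l \<in> states" "riemann_solvable p l r"
  shows "x < snd r \<Longrightarrow> riemann_w p (RS p l r x) = max (riemann_w p l) x"
    and "snd r < x \<Longrightarrow> RS p l r x = r"
proof -
  have "(x < snd r \<longrightarrow> riemann_w p (RS p l r x) = max (riemann_w p l) x) \<and>
    (snd r < x \<longrightarrow> RS p l r x = r)"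
  proof (cases "snd r \<le> snd l")
    case True
    have w: "snd r \<le> riemann_w p l"
      using True assms p_nonneg[of "fst l"] by (auto simp: riemann_w_eq states_def)
    show ?thesis
      by (rule RS_compression[OF assms(1) True assms(2)]) (use w in auto)
  next
    case False
    then show ?thesis
      using RS_rarefaction[OF assms(1)] by (metis (no_types, lifting)
        diff_add_cancel linorder_not_le riemann_w.simps)
  qed
  then show "x < snd r \<Longrightarrow> riemann_w p (RS p l r x) = max (riemann_w p l) x"
    and "snd r < x \<Longrightarrow> RS p l r x = r" by blast+
qed

end


section \<open>The flux through the origin\<close>

lemma flux_at_0_eq:
  assumes "(u \<longlongrightarrow> a) (at_left 0)" "(u \<longlongrightarrow> b) (at_right 0)" "f1 a = f1 b"
  shows "flux_at_0 u = f1 b"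
  unfolding flux_at_0_def
proof (rule the_equality)
  show "\<exists>ul ur. (u \<longlongrightarrow> ul) (at_left 0) \<and> (u \<longlongrightarrow> ur) (at_right 0) \<and> f1 ul = f1 b \<and> f1 ur = f1 b"
    using assms by blast
next
  fix \<phi>
  assume "\<exists>ul ur. (u \<longlongrightarrow> ul) (at_left 0) \<and> (u \<longlongrightarrow> ur) (at_right 0) \<and> f1 ul = \<phi> \<and> f1 ur = \<phi>"
  then obtain ur where "(u \<longlongrightarrow> ur) (at_right 0)" "f1 ur = \<phi>" by blast
  moreover from this have "ur = b"
    using tendsto_unique[OF trivial_limit_at_right_real] assms(2) by blast
  ultimately show "\<phi> = f1 b" by simp
qed

lemma tendsto_at_right_if_const:
  fixes f :: "real \<Rightarrow> 'a :: topological_space"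
  assumes "c < d" "\<And>x. c < x \<Longrightarrow> x < d \<Longrightarrow> f x = a"
  shows "(f \<longlongrightarrow> a) (at_right c)"
proof (rule tendsto_eventually)
  show "\<forall>\<^sub>F x in at_right c. f x = a"
    using assms by (auto simp: eventually_at_right_field)
qed

lemma tendsto_at_left_if_const:
  fixes f :: "real \<Rightarrow> 'a :: topological_space"
  assumes "d < c" "\<And>x. d < x \<Longrightarrow> x < c \<Longrightarrow> f x = a"
  shows "(f \<longlongrightarrow> a) (at_left c)"
proof (rule tendsto_eventually)
  show "\<forall>\<^sub>F x in at_left c. f x = a"
    using assms by (auto simp: eventually_at_left_field)
qed

context pressure_law
begin

text \<open>A vacuum occupies abscissas beyond \<open>w\<^sup>l \<ge> 0\<close>, so the traces at the origin lie on the
  curve through the left state as long as the contact moves. If the contact rests at the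
  origin, then \<open>v\<^sup>r = 0\<close> and no mass crosses it.\<close>

lemma flux_at_0_on_curve:
  assumes l: "l \<in> states" and r: "r \<in> states" and "riemann_solvable p l r"
    and pos: "0 < flux_at_0 (RS p l r)"
  obtains \<rho> where "0 < snd r" "0 \<le> \<rho>" "flux_at_0 (RS p l r) = \<rho> * (riemann_w p l - p \<rho>)"
proof (cases "snd r \<le> snd l")
  case True
  obtain \<rho> \<sigma> where \<rho>: "0 \<le> \<rho>" "p \<rho> = riemann_w p l - snd r" "\<sigma> \<le> snd r"
    and RS: "\<And>x. RS p l r x = (if x < \<sigma> then l else if x < snd r then (\<rho>, snd r) else r)"
    and rh: "\<sigma> = 0 \<Longrightarrow> f1 l = f1 (\<rho>, snd r)"
    by (rule RS_compression[OF l True assms(3)]) blast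
  have v: "0 \<le> snd r" using r by (auto simp: states_def)
  have contact_at_0: "f1 r = 0" if "snd r = 0" using that by (cases r) simp
  define a where "a = (if 0 \<le> \<sigma> then l else (\<rho>, snd r))"
  define b where "b = (if snd r = 0 then r else if 0 < \<sigma> then l else (\<rho>, snd r))"
  have "(RS p l r \<longlongrightarrow> a) (at_left 0)"
    by (rule tendsto_at_left_if_const[of "if 0 \<le> \<sigma> then -1 else \<sigma>"])
      (use v \<rho> in \<open>auto simp: RS a_def\<close>)
  moreover have "(RS p l r \<longlongrightarrow> b) (at_right 0)"
    by (rule tendsto_at_right_if_const
          [of _ "if snd r = 0 then 1 else if 0 < \<sigma> then \<sigma> else snd r"])
      (use v \<rho> in \<open>auto simp: RS b_def\<close>)
  moreover have "f1 a = f1 b"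
    using rh \<rho> contact_at_0 by (auto simp: a_def b_def)
  ultimately have flux: "flux_at_0 (RS p l r) = f1 b" by (rule flux_at_0_eq)
  have "snd r \<noteq> 0"
    using flux pos contact_at_0 by (auto simp: b_def)
  show thesis
  proof (rule that)
    show "0 < snd r" using v \<open>snd r \<noteq> 0\<close> by simp
    show "0 \<le> fst b" using l \<rho> \<open>snd r \<noteq> 0\<close> by (auto simp: b_def states_def)
    show "flux_at_0 (RS p l r) = fst b * (riemann_w p l - p (fst b))"
      unfolding flux using \<rho> \<open>snd r \<noteq> 0\<close> by (cases l) (auto simp: b_def)
  qed
next
  case False
  then have less: "snd l < snd r" by simp
  obtain P where cont: "continuous_on UNIV P" and P: "\<And>x. 0 \<le> P x"
    and RS: "\<And>x. x < snd r \<Longrightarrow> RS p l r x = (P x, max (riemann_w p l) x - p (P x))"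
    by (rule RS_rarefaction[OF l less], erule that)
  have v: "0 < snd r" and w: "0 \<le> riemann_w p l"
    using l less p_nonneg[of "fst l"] by (auto simp: states_def riemann_w_eq)
  define g where "g = (\<lambda>x. (P x, max (riemann_w p l) x - p (P x)))"
  have "continuous_on UNIV g"
    unfolding g_def
    by (intro continuous_intros cont continuous_on_compose2[OF continuous_on_p]) (use P in auto)
  then have "(g \<longlongrightarrow> g 0) (at 0)"
    by (simp add: continuous_on_def)
  moreover have "\<forall>\<^sub>F x in at 0. g x = RS p l r x"
    using eventually_at_in_open'[of "{..<snd r}" 0] v
    by (auto elim!: eventually_mono simp: g_def RS)
  ultimately have "(RS p l r \<longlongrightarrow> g 0) (at 0)"
    by (blast intro: Lim_transform_eventually)
  then have "flux_at_0 (RS p l r) = f1 (g 0)"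
    by (intro flux_at_0_eq[of _ "g 0"]) (auto simp: filterlim_at_split)
  then show thesis
    using that[of "P 0"] v w P by (simp add: g_def max_def)
qed


section \<open>States on the constraint\<close>

lemma I1_iff: "\<rho> \<in> I1 p q l \<longleftrightarrow> 0 \<le> \<rho> \<and> \<rho> * (riemann_w p l - p \<rho>) = q"
  by (simp add: I1_def riemann_w_eq)

text \<open>Along the curve \<open>w = w\<^sup>l\<close> the flux \<open>\<rho> (w - p(\<rho>))\<close> is strictly concave, so it takes the
  value \<open>q\<close> at most twice. This makes the extrema of the solution set exist even when a bounded
  pressure lets the flux grow without bound.\<close>

lemma finite_I1: "finite (I1 p q l)"
proof (rule ccontr)
  assume inf: "infinite (I1 p q l)"
  then obtain T where T: "T \<subseteq> I1 p q l" "finite T" "card T = 3"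
    using infinite_arbitrarily_large by blast
  have *: False if abc: "a \<in> I1 p q l" "b \<in> I1 p q l" "c \<in> I1 p q l" "a < b" "b < c" for a b c
  proof -
    define t where "t = (b - a) / (c - a)"
    have t: "0 < t" "t < 1" using abc by (auto simp: t_def)
    have b: "(1 - t) * a + t * c = b"
    proof -
      have "t * (c - a) = b - a" using abc by (simp add: t_def)
      then show ?thesis by (simp add: algebra_simps)
    qed
    have F: "x * p x = x * riemann_w p l - q" if "x \<in> I1 p q l" for x
      using that by (auto simp: I1_iff algebra_simps)
    have "b * p b < (1 - t) * (a * p a) + t * (c * p c)"
      using strict_convexity[of a c t] abc t by (auto simp: b I1_iff)
    also have "\<dots> = ((1 - t) * a + t * c) * riemann_w p l - q"
      unfolding F[OF abc(1)] F[OF abc(3)] by (simp add: algebra_simps)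
    finally show False using F[OF abc(2)] b by simp
  qed
  define a c where "a = Min T" and "c = Max T"
  have "T \<noteq> {}" using T by auto
  have "T \<subseteq> {a, c}"
  proof
    fix b assume "b \<in> T"
    then have "a \<le> b" "b \<le> c" using T by (auto simp: a_def c_def)
    moreover have "a \<in> T" "c \<in> T" using T \<open>T \<noteq> {}\<close> by (auto simp: a_def c_def)
    ultimately show "b \<in> {a, c}" using *[of a b c] T \<open>b \<in> T\<close> by force
  qed
  then have "card T \<le> card {a, c}" by (intro card_mono) auto
  also have "\<dots> \<le> 2" by (simp add: card_insert_if)
  finally show False using T by simp
qed

lemma I1_nonempty:
  assumes "0 \<le> q" "0 \<le> \<rho>" "q \<le> \<rho> * (riemann_w p l - p \<rho>)"
  shows "I1 p q l \<noteq> {}"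
proof -
  have "continuous_on {0..\<rho>} (\<lambda>\<rho>. \<rho> * (riemann_w p l - p \<rho>))"
    by (intro continuous_intros continuous_on_subset[OF continuous_on_p]) auto
  then show ?thesis
    using IVT'[of "\<lambda>\<rho>. \<rho> * (riemann_w p l - p \<rho>)" 0 q \<rho>] assms by (auto simp: I1_iff)
qed

text \<open>Both constrained states on the curve of the left state share its invariant, and their
  velocity is positive because they carry the positive flux \<open>q\<close>.\<close>

lemma I1_state:
  assumes "0 < q" "\<rho> \<in> I1 p q l"
  shows "(\<rho>, q / \<rho>) \<in> states" "0 < q / \<rho>" "riemann_w p (\<rho>, q / \<rho>) = riemann_w p l"
proof -
  have "\<rho> \<noteq> 0" and eq: "\<rho> * (riemann_w p l - p \<rho>) = q" and "0 \<le> \<rho>"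
    using assms by (auto simp: I1_iff)
  then have "riemann_w p l - p \<rho> = q / \<rho>" by (auto simp: field_simps)
  moreover have "0 < q / \<rho>" using \<open>\<rho> \<noteq> 0\<close> \<open>0 \<le> \<rho>\<close> assms by simp
  ultimately show "(\<rho>, q / \<rho>) \<in> states" "0 < q / \<rho>" "riemann_w p (\<rho>, q / \<rho>) = riemann_w p l"
    using \<open>0 \<le> \<rho>\<close> by (auto simp: states_def)
qed

lemma hat_state_I1:
  assumes "I1 p q l \<noteq> {}"
  obtains \<rho> where "\<rho> \<in> I1 p q l" "hat_state p q l = (\<rho>, q / \<rho>)"
proof -
  have "(GREATEST \<rho>. \<rho> \<in> I1 p q l) = Max (I1 p q l)"
    by (rule Greatest_equality) (use assms finite_I1 in auto)
  then show thesis
    using that[of "Max (I1 p q l)"] assms finite_I1 by (simp add: hat_state_def Let_def)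
qed

lemma check_state1_I1:
  assumes "I1 p q l \<noteq> {}"
  obtains \<rho> where "\<rho> \<in> I1 p q l" "check_state1 p q l = (\<rho>, q / \<rho>)"
proof -
  have "(LEAST \<rho>. \<rho> \<in> I1 p q l) = Min (I1 p q l)"
    by (rule Least_equality) (use assms finite_I1 in auto)
  then show thesis
    using that[of "Min (I1 p q l)"] assms finite_I1 by (simp add: check_state1_def Let_def)
qed

end


section \<open>Essential total variation\<close>

lemma pointwise_variation_le_if_monotone:
  assumes mono: "mono g \<or> antimono g" and range: "\<And>x. g x \<in> {a..b}"
  shows "pointwise_variation g \<le> ennreal (b - a)"
  unfolding pointwise_variation_def
proof (rule SUP_least, clarify)
  fix n :: nat and t :: "nat \<Rightarrow> real"
  assume t: "mono_on {..n} t"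
  have step: "t i \<le> t (Suc i)" if "i < n" for i
    by (rule mono_onD[OF t]) (use that in auto)
  have "(\<Sum>i<n. ennreal \<bar>g (t (Suc i)) - g (t i)\<bar>) = ennreal (\<Sum>i<n. \<bar>g (t (Suc i)) - g (t i)\<bar>)"
    by simp
  also have "(\<Sum>i<n. \<bar>g (t (Suc i)) - g (t i)\<bar>) = \<bar>g (t n) - g (t 0)\<bar>"
    using mono
  proof
    assume "mono g"
    then have "(\<Sum>i<n. \<bar>g (t (Suc i)) - g (t i)\<bar>) = (\<Sum>i<n. g (t (Suc i)) - g (t i))"
      using step by (intro sum.cong refl abs_of_nonneg) (simp add: monoD)
    moreover have "g (t 0) \<le> g (t n)"
      using \<open>mono g\<close> t by (auto intro!: monoD[of g] mono_onD[OF t])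
    ultimately show ?thesis by (simp add: sum_lessThan_telescope[of "\<lambda>i. g (t i)"])
  next
    assume "antimono g"
    then have "(\<Sum>i<n. \<bar>g (t (Suc i)) - g (t i)\<bar>) = (\<Sum>i<n. g (t i) - g (t (Suc i)))"
      using step by (intro sum.cong refl) (simp add: antimonoD)
    moreover have "g (t n) \<le> g (t 0)"
      using \<open>antimono g\<close> t by (auto intro!: antimonoD[of g] mono_onD[OF t])
    ultimately show ?thesis by (simp add: sum_lessThan_telescope'[of "\<lambda>i. g (t i)"])
  qed
  also have "ennreal \<dots> \<le> ennreal (b - a)"
    using range[of "t n"] range[of "t 0"] by (intro ennreal_leI) auto
  finally show "(\<Sum>i<n. ennreal \<bar>g (t (Suc i)) - g (t i)\<bar>) \<le> ennreal (b - a)" .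
qed

lemma pointwise_variation_ge:
  assumes "x \<le> y"
  shows "ennreal \<bar>g y - g x\<bar> \<le> pointwise_variation g"
proof -
  define t where "t = (\<lambda>i::nat. if i = 0 then x else y)"
  have "mono_on {..1} t" using assms by (auto simp: t_def mono_on_def)
  then have "(\<Sum>i<1. ennreal \<bar>g (t (Suc i)) - g (t i)\<bar>) \<le> pointwise_variation g"
    unfolding pointwise_variation_def by (intro SUP_upper2[of "(1, t)"]) auto
  then show ?thesis by (simp add: t_def)
qed

lemma AE_lborel_obtain_between:
  fixes a b :: real
  assumes "AE x in lborel. P x" "a < b"
  obtains x where "a < x" "x < b" "P x"
proof -
  have "\<exists>x. a < x \<and> x < b \<and> P x"
  proof (rule ccontr)
    assume "\<not> ?thesis"
    then have "AE x in lborel. x \<notin> {a<..<b}"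
      using assms(1) by (auto elim!: eventually_mono)
    then have "{a<..<b} \<in> null_sets lborel"
      by (subst AE_iff_null_sets) auto
    then show False using assms(2) by (simp add: null_sets_def)
  qed
  then show thesis using that by blast
qed

text \<open>A representative agrees with the function somewhere in each of the two half-lines, so it
  has to bridge the gap between the two end values.\<close>

lemma tot_var_ge_if_const_at_ends:
  assumes "\<And>x. x < c \<Longrightarrow> f x = a" "\<And>x. d < x \<Longrightarrow> f x = b" "c \<le> d"
  shows "ennreal \<bar>b - a\<bar> \<le> tot_var f"
  unfolding tot_var_def
proof (rule INF_greatest, clarify)
  fix g assume g: "AE x in lborel. g x = f x"
  obtain x where x: "c - 1 < x" "x < c" "g x = f x"
    by (rule AE_lborel_obtain_between[OF g, of "c - 1" c]) auto
  obtain y where y: "d < y" "y < d + 1" "g y = f y"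
    by (rule AE_lborel_obtain_between[OF g, of d "d + 1"]) auto
  have "ennreal \<bar>g y - g x\<bar> \<le> pointwise_variation g"
    by (rule pointwise_variation_ge) (use x y assms in auto)
  then show "ennreal \<bar>b - a\<bar> \<le> pointwise_variation g"
    using x y assms by simp
qed

lemma tot_var_le_if_monotone_off_point:
  assumes "mono g \<or> antimono g" "\<And>x. g x \<in> {a..b}" "\<And>x. x \<noteq> c \<Longrightarrow> f x = g x"
  shows "tot_var f \<le> ennreal (b - a)"
proof -
  have "AE x in lborel. g x = f x"
    using AE_lborel_singleton[of c] by eventually_elim (use assms in auto)
  then have "tot_var f \<le> pointwise_variation g"
    unfolding tot_var_def by (intro INF_lower) auto
  also have "\<dots> \<le> ennreal (b - a)"
    by (rule pointwise_variation_le_if_monotone[OF assms(1,2)])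
  finally show ?thesis .
qed


section \<open>Comparison of the constrained solvers\<close>

theorem proposition4p4:
  fixes p :: "real \<Rightarrow> real" and q :: real and l r :: state
  assumes "pressure p"
    and "q > 0"
    and "l \<in> states" and "r \<in> states"
    and "riemann_solvable p l r"
  shows "tot_var (\<lambda>x. riemann_w p (RSq1 p q l r x)) \<le> tot_var (\<lambda>x. riemann_w p (RSq2 p q l r x))"
proof (cases "flux_at_0 (RS p l r) \<le> q")
  case True
  then show ?thesis by (simp add: RSq1_def RSq2_def RSq_via_def)
next
  case False
  interpret pressure_law p by (rule pressure_law.intro) fact
  define wl wr where "wl = riemann_w p l" and "wr = riemann_w p r"
  have nn: "0 \<le> wl" "snd r \<le> wr"
    using assms p_nonneg[of "fst l"] p_nonneg[of "fst r"] by (auto simp: wl_def wr_def riemann_w_eq states_def)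
  \<comment> \<open>The flux vanishes at density \<open>0\<close> and exceeds \<open>q\<close> at the trace, so it equals
    \<open>q\<close> somewhere on the curve.\<close>
  obtain \<rho> where v: "0 < snd r" and \<rho>: "0 \<le> \<rho>" "flux_at_0 (RS p l r) = \<rho> * (wl - p \<rho>)"
    using flux_at_0_on_curve[OF assms(3-5)] False assms(2) unfolding wl_def
    by (metis linorder_not_le order_less_trans)
  then have I1: "I1 p q l \<noteq> {}"
    using I1_nonempty[of q \<rho> l] False assms(2) by (simp add: wl_def)

  have left: "riemann_w p (RS p l (hat_state p q l) x) = wl" if "x < 0" for x
  proof -
    obtain \<rho> where "\<rho> \<in> I1 p q l" and h: "hat_state p q l = (\<rho>, q / \<rho>)"
      using hat_state_I1[OF I1] .
    note s = I1_state[OF assms(2) this(1)]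
    have "\<rho> \<in> I2 p l (\<rho>, q / \<rho>)"
      using s by (auto simp: I2_iff states_def)
    then have "riemann_solvable p l (\<rho>, q / \<rho>)"
      by (auto simp: riemann_solvable_def)
    from riemann_w_RS(1)[OF assms(3) this, of x] show ?thesis
      using that s(2) nn by (simp add: h wl_def max_def)
  qed

  have "tot_var (\<lambda>x. riemann_w p (RSq1 p q l r x)) \<le> ennreal (max wl wr - min wl wr)"
  proof (rule tot_var_le_if_monotone_off_point)
    let ?c = "check_state1 p q l"
    obtain \<rho> where "\<rho> \<in> I1 p q l" and c: "?c = (\<rho>, q / \<rho>)"
      using check_state1_I1[OF I1] .
    note s = I1_state[OF assms(2) this(1), folded c]
    have "riemann_solvable p ?c r"
    proof (unfold riemann_solvable_def, intro impI)
      assume "snd r \<le> snd ?c"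
      also have "\<dots> \<le> wl"
        using s p_nonneg[of "fst ?c"] by (auto simp: wl_def riemann_w_eq states_def)
      finally have "rho_m p l r \<in> I2 p l r"
        using curve_reaches_right_velocity[OF assms(3,5)] by (simp add: wl_def)
      then show "I2 p ?c r \<noteq> {}" using s(3) by (auto simp: I2_iff)
    qed
    note w = riemann_w_RS[OF s(1) this]
    \<comment> \<open>The jump of \<open>w\<close> at the contact dominates the growth of \<open>w\<close> in the vacuum,
      because \<open>v\<^sup>r \<le> w\<^sup>r\<close>.\<close>
    define g where "g = (\<lambda>x. if x < snd r then max wl x else wr)"
    show "mono g \<or> antimono g"
    proof (cases "wl \<le> wr")
      case True
      then have "mono g" using nn by (auto simp: g_def mono_def)
      then show ?thesis ..
    next
      case False
      then have "antimono g" using nn by (auto simp: g_def antimono_def)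
      then show ?thesis ..
    qed
    show "g x \<in> {min wl wr..max wl wr}" for x
      using nn by (auto simp: g_def)
    show "riemann_w p (RSq1 p q l r x) = g x" if "x \<noteq> snd r" for x
      using that False left[of x] w[of x] s(3) v nn
      by (auto simp: RSq1_def RSq_via_def g_def wl_def wr_def)
  qed
  also have "max wl wr - min wl wr = \<bar>wr - wl\<bar>"
    by (simp add: max_def min_def)
  also have "ennreal \<bar>wr - wl\<bar> \<le> tot_var (\<lambda>x. riemann_w p (RSq2 p q l r x))"
  proof (rule tot_var_ge_if_const_at_ends)
    let ?c = "check_state2 q r"
    have "?c \<in> states" using assms v by (auto simp: check_state2_def states_def)
    moreover have "fst ?c \<in> I2 p ?c r"
      using v assms by (auto simp: I2_iff check_state2_def)
    then have "riemann_solvable p ?c r"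
      by (auto simp: riemann_solvable_def)
    ultimately show "riemann_w p (RSq2 p q l r x) = wr" if "snd r < x" for x
      using that False v riemann_w_RS(2)[of ?c r x]
      by (auto simp: RSq2_def RSq_via_def wr_def)
    show "riemann_w p (RSq2 p q l r x) = wl" if "x < 0" for x
      using that False left[of x] by (simp add: RSq2_def RSq_via_def)
  qed (use v in simp)
  finally show ?thesis .
qed

end
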